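(* Let $(G,\sigma,w)$ be a positive connected signed graph with consensus index $\epsilon_0$. For any $\epsilon_1<\epsilon_2<\epsilon_0$ and for all $i,j\in V$, $$\Omega_{\epsilon_1}^{\sigma}(i,j)\le \Omega_{\epsilon_2}^{\sigma}(i,j).$$ In particular, if $\Omega(i,j)$ denotes the resistance between $i$ and $j$ on the underlying graph $G$, then for any $0<\epsilon<\epsilon_0$ and all $i,j\in V$, $$\Omega(i,j)\le\Omega_\epsilon^\sigma(i,j).$$
   Context: A signed graph $(G,\sigma,w)$ consists of a finite simple undirected connected graph $G=(V,E)$, a symmetric signature $\sigma:E\to\{+1,-1\}$ and a symmetric weight $w:E\to\mathbb{R}_{\ge 0}$. Put $E_+=\sigma^{-1}(+1)$, $E_-=\sigma^{-1}(-1)$. Let $w^{\pm}$ be the restriction of $w$ to $E_\pm$, extended by zero to all pairs of vertices. Put $d_i^{\pm}=\sum_{j:(i,j)\in E_\pm}w_{ij}$. The signed graph is positive connected if its positive subgraph $(V,E_+,w^+)$ is connected. The matrices $L_\pm\in\mathbb{R}^{V\times V}$ are the Laplacians of $(V,E_\pm,w^\pm)$: $L_\pm(i,i)=d_i^\pm$, $L_\pm(i,j)=-w_{ij}$ if $(i,j)\in E_\pm$, and $L_\pm(i,j)=0$ otherwise. The consensus index is $$\epsilon_0:=\sup\{\epsilon>0 : L_+-\epsilon L_-\text{ is positive semidefinite of rank } |V|-1\}$$ (the value $+\infty$ is allowed). For real $\epsilon<\epsilon_0$ (possibly negative) the $\epsilon$-repelling cost is $$\Omega_\epsilon^\sigma(i,j):=(\vec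 e_i-\vec e_j)^T(L_+-\epsilon L_-)^{\dagger}(\vec e_i-\vec e_j),$$ where $\dagger$ is the Moore–Penrose pseudoinverse and $\vec e_i$ are the standard basis vectors. The resistance on $G$ is $\Omega(i,j):=(\vec e_i-\vec e_j)^T(L_++L_-)^\dagger(\vec e_i-\vec e_j)$. *)

theory Defs
  imports "HOL-Analysis.Analysis"
begin

(* The vertex set V is the finite type 'v, so |V| = CARD('v). Undirected edges are stored as
   symmetric sets of ordered pairs; signs and weights are only constrained on edges. *)

definition connected_edges :: "('v \<times> 'v) set \<Rightarrow> bool" where
  "connected_edges F \<longleftrightarrow> (\<forall>i j. (i, j) \<in> F\<^sup>*)"

locale signed_graph =
  fixes E :: "('v::finite \<times> 'v) set"
    and \<sigma> :: "'v \<Rightarrow> 'v \<Rightarrow> int"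
    and w :: "'v \<Rightarrow> 'v \<Rightarrow> real"
  assumes sym_E: "sym E"
    and irrefl_E: "irrefl E"
    and connected_E: "connected_edges E"
    and sign_values: "\<And>i j. (i, j) \<in> E \<Longrightarrow> \<sigma> i j \<in> {1, -1}"
    and sign_sym: "\<And>i j. (i, j) \<in> E \<Longrightarrow> \<sigma> i j = \<sigma> j i"
    and weight_nonneg: "\<And>i j. (i, j) \<in> E \<Longrightarrow> 0 \<le> w i j"
    and weight_sym: "\<And>i j. (i, j) \<in> E \<Longrightarrow> w i j = w j i"

definition pos_edges :: "('v \<times> 'v) set \<Rightarrow> ('v \<Rightarrow> 'v \<Rightarrow> int) \<Rightarrow> ('v \<times> 'v) set" where
  "pos_edges E \<sigma> = {(i, j). (i, j) \<in> E \<and> \<sigma> i j = 1}"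

definition neg_edges :: "('v \<times> 'v) set \<Rightarrow> ('v \<Rightarrow> 'v \<Rightarrow> int) \<Rightarrow> ('v \<times> 'v) set" where
  "neg_edges E \<sigma> = {(i, j). (i, j) \<in> E \<and> \<sigma> i j = -1}"

(* Connectivity of the edge set: edges of weight zero count as edges. *)
definition positive_connected :: "('v \<times> 'v) set \<Rightarrow> ('v \<Rightarrow> 'v \<Rightarrow> int) \<Rightarrow> bool" where
  "positive_connected E \<sigma> \<longleftrightarrow> connected_edges (pos_edges E \<sigma>)"

definition weighted_degree ::
    "('v::finite \<times> 'v) set \<Rightarrow> ('v \<Rightarrow> 'v \<Rightarrow> real) \<Rightarrow> 'v \<Rightarrow> real" where
  "weighted_degree F w i = (\<Sum>j\<in>{j. (i, j) \<in> F}. w i j)"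

definition laplacian ::
    "('v::finite \<times> 'v) set \<Rightarrow> ('v \<Rightarrow> 'v \<Rightarrow> real) \<Rightarrow> real ^ 'v ^ 'v" where
  "laplacian F w = (\<chi> i j. if i = j then weighted_degree F w i
                           else if (i, j) \<in> F then - w i j else 0)"

definition L_pos ::
    "('v::finite \<times> 'v) set \<Rightarrow> ('v \<Rightarrow> 'v \<Rightarrow> int) \<Rightarrow> ('v \<Rightarrow> 'v \<Rightarrow> real) \<Rightarrow> real ^ 'v ^ 'v" where
  "L_pos E \<sigma> w = laplacian (pos_edges E \<sigma>) w"

definition L_neg ::
    "('v::finite \<times> 'v) set \<Rightarrow> ('v \<Rightarrow> 'v \<Rightarrow> int) \<Rightarrow> ('v \<Rightarrow> 'v \<Rightarrow> real) \<Rightarrow> real ^ 'v ^ 'v" where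
  "L_neg E \<sigma> w = laplacian (neg_edges E \<sigma>) w"

definition repelling_laplacian ::
    "('v::finite \<times> 'v) set \<Rightarrow> ('v \<Rightarrow> 'v \<Rightarrow> int) \<Rightarrow> ('v \<Rightarrow> 'v \<Rightarrow> real) \<Rightarrow> real \<Rightarrow> real ^ 'v ^ 'v" where
  "repelling_laplacian E \<sigma> w \<epsilon> = L_pos E \<sigma> w - \<epsilon> *\<^sub>R L_neg E \<sigma> w"

definition positive_semidefinite :: "real ^ 'n ^ 'n \<Rightarrow> bool" where
  "positive_semidefinite A \<longleftrightarrow> transpose A = A \<and> (\<forall>x. 0 \<le> x \<bullet> (A *v x))"

(* The supremum is taken in [0, \<infinity>]: it is \<infinity> for an unbounded set, and 0 for the empty set. For
   a positive connected graph the set is empty only if zero weights make L_+ have rank less than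
   |V| - 1. *)
definition consensus_index ::
    "('v::finite \<times> 'v) set \<Rightarrow> ('v \<Rightarrow> 'v \<Rightarrow> int) \<Rightarrow> ('v \<Rightarrow> 'v \<Rightarrow> real) \<Rightarrow> ereal" where
  "consensus_index E \<sigma> w = enn2ereal (SUP \<epsilon> \<in> {\<epsilon>. 0 < \<epsilon> \<and>
     positive_semidefinite (repelling_laplacian E \<sigma> w \<epsilon>) \<and>
     rank (repelling_laplacian E \<sigma> w \<epsilon>) = CARD('v) - 1}. ennreal \<epsilon>)"

definition is_pseudoinverse :: "real ^ 'n ^ 'm \<Rightarrow> real ^ 'm ^ 'n \<Rightarrow> bool" where
  "is_pseudoinverse A X \<longleftrightarrow>
     A ** X ** A = A \<and> X ** A ** X = X \<and>
     transpose (A ** X) = A ** X \<and> transpose (X ** A) = X ** A"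

definition pseudoinverse :: "real ^ 'n ^ 'm \<Rightarrow> real ^ 'm ^ 'n" where
  "pseudoinverse A = (THE X. is_pseudoinverse A X)"

lemma is_pseudoinverse_unique:
  assumes "is_pseudoinverse A X" and "is_pseudoinverse A Y"
  shows "X = Y"
proof -
  note X = assms(1)[unfolded is_pseudoinverse_def]
  note Y = assms(2)[unfolded is_pseudoinverse_def]
  have "A ** X = transpose (A ** X)" using X by simp
  also have "\<dots> = transpose ((A ** Y) ** (A ** X))"
    using Y by (simp add: matrix_mul_assoc)
  also have "\<dots> = (A ** X) ** (A ** Y)"
    using X Y by (simp add: matrix_transpose_mul[of "A ** Y" "A ** X"])
  also have "\<dots> = A ** Y" using X by (simp add: matrix_mul_assoc)
  finally have AX: "A ** X = A ** Y" .
  have "X ** A = transpose (X ** A)" using X by simp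
  also have "\<dots> = transpose ((X ** A) ** (Y ** A))"
    using Y by (metis matrix_mul_assoc)
  also have "\<dots> = (Y ** A) ** (X ** A)"
    using X Y by (simp add: matrix_transpose_mul[of "X ** A" "Y ** A"])
  also have "\<dots> = Y ** A" using X by (metis matrix_mul_assoc)
  finally have XA: "X ** A = Y ** A" .
  have "X = X ** (A ** X)" using X by (simp add: matrix_mul_assoc)
  also have "\<dots> = Y ** A ** Y" by (simp add: AX XA matrix_mul_assoc)
  also have "\<dots> = Y" using Y by simp
  finally show ?thesis .
qed

lemma is_pseudoinverse_exists:
  fixes A :: "real ^ 'n ^ 'm"
  shows "\<exists>X. is_pseudoinverse A X"
proof -
  define S where "S = range (\<lambda>x. A *v x)"
  define K where "K = {x. A *v x = 0}"
  have S: "subspace S" unfolding S_def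
    by (simp add: linear_subspace_image)
  have K: "subspace K" unfolding K_def
    by (auto simp: subspace_def matrix_vector_right_distrib matrix_vector_mult_scaleR)
  let ?P = "\<lambda>y z. (\<forall>k\<in>K. z \<bullet> k = 0) \<and> (\<forall>s\<in>S. (A *v z - y) \<bullet> s = 0)"
  have ex: "\<exists>z. ?P y z" for y
  proof -
    obtain s t where st: "s \<in> span S" "\<And>v. v \<in> span S \<Longrightarrow> orthogonal t v" "y = s + t"
      using orthogonal_subspace_decomp_exists[of S y] by metis
    have "s \<in> S" using st(1) S by (metis span_eq_iff)
    then obtain x where x: "s = A *v x" by (auto simp: S_def)
    obtain k z where kz: "k \<in> span K" "\<And>v. v \<in> span K \<Longrightarrow> orthogonal z v" "x = k + z"
      using orthogonal_subspace_decomp_exists[of K x] by metis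
    have "A *v k = 0" using kz(1) K by (metis K_def mem_Collect_eq span_eq_iff)
    then have "A *v z - y = - t"
      using st x kz by (simp add: matrix_vector_right_distrib)
    then have "?P y z"
      using st kz by (auto simp: orthogonal_def span_base)
    then show ?thesis by blast
  qed
  have uniq: "z = z'" if "?P y z" "?P y z'" for y z z'
  proof -
    have "A *v (z - z') = (A *v z - y) - (A *v z' - y)"
      by (simp add: matrix_vector_mult_diff_distrib)
    moreover have "A *v (z - z') \<in> S" by (simp add: S_def)
    ultimately have "(A *v (z - z')) \<bullet> (A *v (z - z')) = 0"
      using that by (metis inner_diff_left diff_self)
    then have "z - z' \<in> K" by (simp add: K_def)
    then have "(z - z') \<bullet> (z - z') = 0"
      using that by (metis inner_diff_left diff_self)
    then show ?thesis by simp
  qed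
  obtain f where f: "\<And>y. ?P y (f y)" using ex by metis
  have "linear f"
  proof (rule linearI)
    fix a b
    have "?P (a + b) (f a + f b)"
      using f[of a] f[of b]
      by (simp add: inner_add_left matrix_vector_right_distrib inner_diff_left)
    then show "f (a + b) = f a + f b" using f uniq by blast
  next
    fix c :: real and a
    have "?P (c *\<^sub>R a) (c *\<^sub>R f a)"
      using f[of a]
      by (simp add: matrix_vector_mult_scaleR inner_diff_left)
    then show "f (c *\<^sub>R a) = c *\<^sub>R f a" using f uniq by blast
  qed
  then have X: "matrix f *v y = f y" for y
    by (simp add: matrix_works)
  let ?X = "matrix f"
  have 1: "A *v f (A *v x) = A *v x" for x
  proof -
    have "A *v f (A *v x) - A *v x = A *v (f (A *v x) - x)"
      by (simp add: matrix_vector_mult_diff_distrib)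
    then have "A *v f (A *v x) - A *v x \<in> S" by (simp add: S_def)
    then have "(A *v f (A *v x) - A *v x) \<bullet> (A *v f (A *v x) - A *v x) = 0"
      using f by blast
    then show ?thesis by simp
  qed
  have 2: "f (A *v f y) = f y" for y
    using f[of "A *v f y"] f[of y] uniq[of "f y" "A *v f y" "f (A *v f y)"] by simp
  have sym: "transpose M = M" if "\<And>x y. (M *v x) \<bullet> y = x \<bullet> (M *v y)" for M :: "real ^ 'k ^ 'k"
  proof -
    have "(transpose M *v x - M *v x) \<bullet> y = 0" for x y
      by (metis dot_lmul_matrix inner_commute inner_diff_left diff_self that
          transpose_matrix_vector)
    then have "transpose M *v x = M *v x" for x
      by (metis inner_eq_zero_iff right_minus_eq)
    then show ?thesis by (simp add: matrix_eq)
  qed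
  have 3: "(A *v f x) \<bullet> y = x \<bullet> (A *v f y)" for x y
  proof -
    have "(A *v f y - y) \<bullet> (A *v f x) = 0" "(A *v f x - x) \<bullet> (A *v f y) = 0"
      using f by (auto simp: S_def)
    then show ?thesis by (simp add: inner_diff_left inner_diff_right inner_commute)
  qed
  have 4: "f (A *v x) \<bullet> y = x \<bullet> f (A *v y)" for x y
  proof -
    have "y - f (A *v y) \<in> K" "x - f (A *v x) \<in> K"
      by (simp_all add: K_def matrix_vector_mult_diff_distrib 1)
    then have "f (A *v x) \<bullet> (y - f (A *v y)) = 0" "f (A *v y) \<bullet> (x - f (A *v x)) = 0"
      using f by blast+
    then show ?thesis by (simp add: inner_diff_right inner_commute)
  qed
  have "is_pseudoinverse A ?X"
    unfolding is_pseudoinverse_def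
    by (intro conjI sym)
      (simp_all add: matrix_eq matrix_vector_mul_assoc[symmetric] X 1 2 3 4)
  then show ?thesis by blast
qed

lemma is_pseudoinverse_pseudoinverse: "is_pseudoinverse A (pseudoinverse A)"
  unfolding pseudoinverse_def
  by (rule theI') (metis is_pseudoinverse_exists is_pseudoinverse_unique)

definition effective_cost :: "real ^ 'v ^ 'v \<Rightarrow> 'v::finite \<Rightarrow> 'v \<Rightarrow> real" where
  "effective_cost L i j = (axis i 1 - axis j 1) \<bullet> (pseudoinverse L *v (axis i 1 - axis j 1))"

definition repelling_cost ::
    "('v::finite \<times> 'v) set \<Rightarrow> ('v \<Rightarrow> 'v \<Rightarrow> int) \<Rightarrow> ('v \<Rightarrow> 'v \<Rightarrow> real) \<Rightarrow> real \<Rightarrow> 'v \<Rightarrow> 'v \<Rightarrow> real" where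
  "repelling_cost E \<sigma> w \<epsilon> i j = effective_cost (repelling_laplacian E \<sigma> w \<epsilon>) i j"

definition resistance ::
    "('v::finite \<times> 'v) set \<Rightarrow> ('v \<Rightarrow> 'v \<Rightarrow> int) \<Rightarrow> ('v \<Rightarrow> 'v \<Rightarrow> real) \<Rightarrow> 'v \<Rightarrow> 'v \<Rightarrow> real" where
  "resistance E \<sigma> w i j = effective_cost (L_pos E \<sigma> w + L_neg E \<sigma> w) i j"

end

theory Submission
  imports Defs
begin

text \<open>
  Write $M(\epsilon) = L_+ - \epsilon L_-$.  Since $L_-$ is positive semidefinite, $M(\epsilon)$
  decreases in the Loewner order as $\epsilon$ grows, and the claim is that inversion reverses this
  order.  For pseudoinverses the reversal fails in general: it needs the two matrices to have the
  same kernel, so that both pseudoinverses first project orthogonally onto one common range.  With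
  equal kernels it follows from one completed square (\<open>pseudoinverse_quadratic_form_antimono\<close>).

  The kernels agree because $\epsilon_2$ is strictly below the consensus index.  This gives some
  $\delta > \epsilon_2$ with $M(\delta)$ still positive semidefinite: one of the parameters in the
  supremum if $\epsilon_2 \ge 0$, and $\delta = 0$ if $\epsilon_2 < 0$, which also covers the
  degenerate case of consensus index zero.  A vector in the kernel of
  $M(\epsilon_2) = M(\delta) + (\delta - \epsilon_2) L_-$ annihilates the quadratic forms of both
  positive semidefinite summands; hence it lies in the kernel of $L_-$, and therefore in that of
  every $M(\epsilon)$.

  The bound for the resistance is the instance $\epsilon_1 = -1$, because $L_+ + L_- = M(-1)$.
\<close>

section \<open>Positive semidefinite matrices\<close>

lemma symmetric_matrix_inner:
  fixes A :: "real ^ 'n ^ 'n"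
  assumes "transpose A = A"
  shows "x \<bullet> (A *v y) = (A *v x) \<bullet> y"
  by (metis assms dot_lmul_matrix transpose_matrix_vector)

text \<open>
  For $y = Ax$ the quadratic form at $x + ty$ is $2t\,\|y\|^2 + t^2\,(y \cdot Ay)$, which would be
  negative for small negative $t$ unless $y = 0$.
\<close>
lemma positive_semidefinite_kernel:
  fixes A :: "real ^ 'n ^ 'n"
  assumes A: "positive_semidefinite A" and x: "x \<bullet> (A *v x) = 0"
  shows "A *v x = 0"
proof -
  define y where "y = A *v x"
  define n where "n = y \<bullet> y"
  define s where "s = y \<bullet> (A *v y)"
  have sym: "transpose A = A" and s: "0 \<le> s"
    using A by (simp_all add: positive_semidefinite_def s_def)
  \<comment> \<open>Adding 1 to \<open>s\<close> keeps the step size defined when \<open>s = 0\<close>.\<close>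
  define t where "t = - n / (s + 1)"
  have xy: "x \<bullet> (A *v y) = n"
    by (simp add: symmetric_matrix_inner[OF sym] n_def flip: y_def)
  have "0 \<le> (x + t *\<^sub>R y) \<bullet> (A *v (x + t *\<^sub>R y))"
    using A by (simp add: positive_semidefinite_def)
  also have "\<dots> = 2 * t * n + t\<^sup>2 * s"
    using x xy
    by (simp add: matrix_vector_right_distrib matrix_vector_mult_scaleR inner_add_left
        inner_add_right s_def[symmetric] power2_eq_square algebra_simps
        flip: y_def n_def)
  finally have "0 \<le> (s + 1)\<^sup>2 * (2 * t * n + t\<^sup>2 * s)" by simp
  also have "\<dots> = 2 * (s + 1) * n * (t * (s + 1)) + s * (t * (s + 1))\<^sup>2"
    by (simp add: power2_eq_square algebra_simps)
  also have "t * (s + 1) = - n"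
    using s by (simp add: t_def)
  also have "2 * (s + 1) * n * (- n) + s * (- n)\<^sup>2 = - (n\<^sup>2 * (s + 2))"
    by (simp add: power2_eq_square algebra_simps)
  finally have "n\<^sup>2 * (s + 2) \<le> 0" by simp
  then have "n = 0"
    using s by (simp add: mult_le_0_iff)
  then show ?thesis by (simp add: n_def y_def)
qed

section \<open>Order reversal of the pseudoinverse\<close>

lemma pseudoinverse_residual_in_kernel:
  fixes A :: "real ^ 'n ^ 'n"
  assumes sym: "transpose A = A"
  shows "A *v (v - A *v (pseudoinverse A *v v)) = 0"
proof -
  let ?X = "pseudoinverse A"
  note X = is_pseudoinverse_pseudoinverse[of A, unfolded is_pseudoinverse_def]
  have "A ** (A ** ?X) = transpose (A ** ?X ** A)"
    using X sym matrix_transpose_mul[of "A ** ?X" A] by simp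
  then have "A ** (A ** ?X) = A"
    using X sym by simp
  then show ?thesis
    by (simp add: matrix_vector_mult_diff_distrib matrix_vector_mul_assoc)
qed

text \<open>
  The residual $v - AXv$ is orthogonal to $Xv = (XA)Xv$, because $XA$ is symmetric and kills the
  kernel of $A$.
\<close>
lemma pseudoinverse_quadratic_form:
  fixes A :: "real ^ 'n ^ 'n"
  assumes sym: "transpose A = A"
  defines "a \<equiv> \<lambda>v. pseudoinverse A *v v"
  shows "v \<bullet> a v = a v \<bullet> (A *v a v)"
proof -
  let ?X = "pseudoinverse A"
  note X = is_pseudoinverse_pseudoinverse[of A, unfolded is_pseudoinverse_def]
  let ?r = "v - A *v a v"
  have fix_a: "(?X ** A) *v a v = a v"
    using X by (simp add: a_def matrix_vector_mul_assoc)
  have "?r \<bullet> a v = ((?X ** A) *v ?r) \<bullet> a v"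
    using X symmetric_matrix_inner[of "?X ** A" ?r "a v"] fix_a by simp
  also have "(?X ** A) *v ?r = 0"
    using pseudoinverse_residual_in_kernel[OF sym, of v]
    by (simp add: a_def flip: matrix_vector_mul_assoc)
  finally have "?r \<bullet> a v = 0" by simp
  then show ?thesis
    by (simp add: inner_diff_left inner_commute[of "A *v a v"])
qed

text \<open>
  For symmetric matrices with one kernel, $AA^\dagger v$ and $BB^\dagger v$ are both the orthogonal
  projection of $v$ onto the orthogonal complement of that kernel.
\<close>
lemma pseudoinverse_projection_cong:
  fixes A B :: "real ^ 'n ^ 'n"
  assumes A: "transpose A = A" and B: "transpose B = B"
    and ker: "\<And>x. A *v x = 0 \<longleftrightarrow> B *v x = 0"
  shows "A *v (pseudoinverse A *v v) = B *v (pseudoinverse B *v v)"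
proof -
  let ?a = "pseudoinverse A *v v" and ?b = "pseudoinverse B *v v"
  let ?d = "A *v ?a - B *v ?b"
  have "A *v (v - A *v ?a) = 0" "A *v (v - B *v ?b) = 0"
    using pseudoinverse_residual_in_kernel[OF A] pseudoinverse_residual_in_kernel[OF B] ker
    by blast+
  then have dA: "A *v ?d = 0"
    by (simp add: matrix_vector_mult_diff_distrib)
  then have dB: "B *v ?d = 0" using ker by blast
  have "?d \<bullet> ?d = (A *v ?d) \<bullet> ?a - (B *v ?d) \<bullet> ?b"
    by (simp only: inner_diff_right symmetric_matrix_inner[OF A] symmetric_matrix_inner[OF B])
  then have "?d \<bullet> ?d = 0" using dA dB by simp
  then show ?thesis by simp
qed

text \<open>
  With $a = A^\dagger v$, $b = B^\dagger v$ and the common projection $p = Aa = Bb$, expanding the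
  square $(a - b) \cdot A(a - b) \ge 0$ gives
  $a \cdot p - 2\, b \cdot p + b \cdot Ab \ge 0$, and $b \cdot Ab \le b \cdot Bb = b \cdot p$.
\<close>
lemma pseudoinverse_quadratic_form_antimono:
  fixes A B :: "real ^ 'n ^ 'n"
  assumes A: "positive_semidefinite A" and B: "transpose B = B"
    and le: "\<And>x. x \<bullet> (A *v x) \<le> x \<bullet> (B *v x)"
    and ker: "\<And>x. A *v x = 0 \<longleftrightarrow> B *v x = 0"
  shows "v \<bullet> (pseudoinverse B *v v) \<le> v \<bullet> (pseudoinverse A *v v)"
proof -
  let ?a = "pseudoinverse A *v v" and ?b = "pseudoinverse B *v v"
  have symA: "transpose A = A" using A by (simp add: positive_semidefinite_def)
  have p: "A *v ?a = B *v ?b"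
    by (rule pseudoinverse_projection_cong[OF symA B ker])
  have "0 \<le> (?a - ?b) \<bullet> (A *v (?a - ?b))"
    using A by (simp add: positive_semidefinite_def)
  also have "\<dots> = ?a \<bullet> (A *v ?a) - 2 * (?b \<bullet> (A *v ?a)) + ?b \<bullet> (A *v ?b)"
    using symmetric_matrix_inner[OF symA, of ?a ?b]
    by (simp add: matrix_vector_mult_diff_distrib inner_diff_left inner_diff_right inner_commute)
  also have "\<dots> \<le> ?a \<bullet> (A *v ?a) - 2 * (?b \<bullet> (B *v ?b)) + ?b \<bullet> (B *v ?b)"
    using le[of ?b] by (simp add: p)
  finally show ?thesis
    by (simp add: pseudoinverse_quadratic_form[OF symA] pseudoinverse_quadratic_form[OF B])
qed

section \<open>The signed Laplacians\<close>

lemma laplacian_mult: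
  assumes "irrefl F"
  shows "(laplacian F w *v x) $ i = (\<Sum>j\<in>UNIV. (if (i, j) \<in> F then w i j else 0) * (x $ i - x $ j))"
proof -
  define u where "u j = (if (i, j) \<in> F then w i j else 0)" for j
  have uii: "u i = 0" using assms by (simp add: u_def irrefl_def)
  have deg: "weighted_degree F w i = (\<Sum>j\<in>UNIV. u j)"
    unfolding weighted_degree_def u_def by (simp add: sum.If_cases)
  have "(laplacian F w *v x) $ i = (\<Sum>j\<in>UNIV. (if i = j then sum u UNIV * x $ i else 0) - u j * x $ j)"
    unfolding matrix_vector_mult_def laplacian_def
    by (simp, rule sum.cong) (auto simp: deg uii, auto simp: u_def)
  also have "\<dots> = (\<Sum>j\<in>UNIV. u j * (x $ i - x $ j))"
    by (simp add: sum_subtractf right_diff_distrib sum_distrib_right)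
  finally show ?thesis by (simp add: u_def)
qed

text \<open>
  Symmetrizing the double sum turns the quadratic form of a Laplacian into the Dirichlet energy
  $\frac12 \sum_{i,j} w_{ij} (x_i - x_j)^2$.
\<close>
lemma positive_semidefinite_laplacian:
  assumes F: "sym F" "irrefl F"
    and nonneg: "\<And>i j. (i, j) \<in> F \<Longrightarrow> 0 \<le> w i j"
    and wsym: "\<And>i j. (i, j) \<in> F \<Longrightarrow> w i j = w j i"
  shows "positive_semidefinite (laplacian F w)"
  unfolding positive_semidefinite_def
proof (intro conjI allI)
  have "(i, j) \<in> F \<longleftrightarrow> (j, i) \<in> F" for i j
    using F(1) by (auto dest: symD)
  then show "transpose (laplacian F w) = laplacian F w"
    using wsym by (auto simp: transpose_def laplacian_def vec_eq_iff)
next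
  fix x :: "real ^ 'a"
  define u where "u i j = (if (i, j) \<in> F then w i j else 0)" for i j
  have u0: "0 \<le> u i j" and usym: "u i j = u j i" for i j
    using nonneg wsym F(1) by (auto simp: u_def dest: symD)
  let ?S = "\<Sum>i\<in>UNIV. \<Sum>j\<in>UNIV. x $ i * (u i j * (x $ i - x $ j))"
  have q: "x \<bullet> (laplacian F w *v x) = ?S"
    by (simp add: inner_vec_def laplacian_mult[OF F(2)] sum_distrib_left u_def)
  have "?S = (\<Sum>i\<in>UNIV. \<Sum>j\<in>UNIV. x $ j * (u j i * (x $ j - x $ i)))"
    by (rule sum.swap)
  then have "?S + ?S = (\<Sum>i\<in>UNIV. \<Sum>j\<in>UNIV.
      x $ i * (u i j * (x $ i - x $ j)) + x $ j * (u j i * (x $ j - x $ i)))"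
    by (simp only: sum.distrib)
  also have "\<dots> = (\<Sum>i\<in>UNIV. \<Sum>j\<in>UNIV. u i j * (x $ i - x $ j)\<^sup>2)"
    using usym by (intro sum.cong refl) (simp add: power2_eq_square algebra_simps)
  also have "\<dots> \<ge> 0" using u0 by (intro sum_nonneg) simp
  finally show "0 \<le> x \<bullet> (laplacian F w *v x)" using q by linarith
qed

context signed_graph
begin

lemma positive_semidefinite_L_pos: "positive_semidefinite (L_pos E \<sigma> w)"
  unfolding L_pos_def using irrefl_E sym_E
  by (intro positive_semidefinite_laplacian)
    (auto simp: pos_edges_def sym_def irrefl_def sign_sym weight_nonneg weight_sym)

lemma positive_semidefinite_L_neg: "positive_semidefinite (L_neg E \<sigma> w)"
  unfolding L_neg_def using irrefl_E sym_E
  by (intro positive_semidefinite_laplacian)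
    (auto simp: neg_edges_def sym_def irrefl_def sign_sym weight_nonneg weight_sym)

lemma repelling_laplacian_decrease:
  "repelling_laplacian E \<sigma> w \<epsilon> *v x =
    repelling_laplacian E \<sigma> w \<delta> *v x + (\<delta> - \<epsilon>) *\<^sub>R (L_neg E \<sigma> w *v x)"
  by (simp add: repelling_laplacian_def matrix_vector_mult_diff_rdistrib
      scaleR_matrix_vector_assoc[symmetric] scaleR_diff_left)

lemma transpose_repelling_laplacian:
  "transpose (repelling_laplacian E \<sigma> w \<epsilon>) = repelling_laplacian E \<sigma> w \<epsilon>"
  using positive_semidefinite_L_pos positive_semidefinite_L_neg
  by (simp add: positive_semidefinite_def repelling_laplacian_def transpose_def vec_eq_iff)

lemma positive_semidefinite_repelling_laplacian_mono:
  assumes "positive_semidefinite (repelling_laplacian E \<sigma> w \<delta>)" and "\<epsilon> \<le> \<delta>"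
  shows "positive_semidefinite (repelling_laplacian E \<sigma> w \<epsilon>)"
  using assms positive_semidefinite_L_neg transpose_repelling_laplacian
  by (auto simp: positive_semidefinite_def repelling_laplacian_decrease[of \<epsilon> _ \<delta>] inner_add_right)

text \<open>
  The set in the supremum is empty when zero weights make every $M(\epsilon)$ with $\epsilon > 0$
  indefinite or rank deficient.  A negative parameter is then below the index with no member of that
  set above it, hence the separate witness $M(0) = L_+$.
\<close>
lemma positive_semidefinite_above_of_less_consensus_index:
  assumes "ereal \<epsilon> < consensus_index E \<sigma> w"
  obtains \<delta> where "\<epsilon> < \<delta>" and "positive_semidefinite (repelling_laplacian E \<sigma> w \<delta>)"
proof (cases "\<epsilon> < 0")
  case True
  moreover have "positive_semidefinite (repelling_laplacian E \<sigma> w 0)"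
    using positive_semidefinite_L_pos by (simp add: repelling_laplacian_def)
  ultimately show ?thesis by (rule that)
next
  case False
  then have "ereal \<epsilon> = enn2ereal (ennreal \<epsilon>)" by simp
  then obtain \<delta> where "ennreal \<epsilon> < ennreal \<delta>"
    "positive_semidefinite (repelling_laplacian E \<sigma> w \<delta>)"
    using assms by (auto simp: consensus_index_def less_SUP_iff simp flip: less_ennreal.rep_eq)
  then show ?thesis using False that by (simp add: ennreal_less_iff)
qed

text \<open>
  The kernel of $M(\epsilon)$ does not depend on the parameter below the consensus index.  Strictness
  matters: at the endpoint of the semidefinite range the kernel may grow.
\<close>
lemma L_neg_vanishes_on_repelling_kernel:
  assumes psd: "positive_semidefinite (repelling_laplacian E \<sigma> w \<delta>)" and "\<epsilon> < \<delta>"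
    and x: "repelling_laplacian E \<sigma> w \<epsilon> *v x = 0"
  shows "L_neg E \<sigma> w *v x = 0"
proof (rule positive_semidefinite_kernel[OF positive_semidefinite_L_neg])
  have nonneg: "0 \<le> x \<bullet> (repelling_laplacian E \<sigma> w \<delta> *v x)" "0 \<le> x \<bullet> (L_neg E \<sigma> w *v x)"
    using psd positive_semidefinite_L_neg by (simp_all add: positive_semidefinite_def)
  have "x \<bullet> (repelling_laplacian E \<sigma> w \<delta> *v x) + (\<delta> - \<epsilon>) * (x \<bullet> (L_neg E \<sigma> w *v x)) = 0"
    using x repelling_laplacian_decrease[of \<epsilon> x \<delta>]
    by (metis inner_add_right inner_scaleR_right inner_zero_right)
  moreover have "0 \<le> (\<delta> - \<epsilon>) * (x \<bullet> (L_neg E \<sigma> w *v x))"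
    using nonneg \<open>\<epsilon> < \<delta>\<close> by simp
  ultimately have "(\<delta> - \<epsilon>) * (x \<bullet> (L_neg E \<sigma> w *v x)) = 0"
    using nonneg(1) by linarith
  then show "x \<bullet> (L_neg E \<sigma> w *v x) = 0" using \<open>\<epsilon> < \<delta>\<close> by simp
qed

lemma repelling_cost_mono:
  assumes less: "\<epsilon>\<^sub>1 < \<epsilon>\<^sub>2" and index: "ereal \<epsilon>\<^sub>2 < consensus_index E \<sigma> w"
  shows "repelling_cost E \<sigma> w \<epsilon>\<^sub>1 i j \<le> repelling_cost E \<sigma> w \<epsilon>\<^sub>2 i j"
proof -
  let ?M = "repelling_laplacian E \<sigma> w" and ?N = "L_neg E \<sigma> w"
  obtain \<delta> where \<delta>: "\<epsilon>\<^sub>2 < \<delta>" "positive_semidefinite (?M \<delta>)"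
    using positive_semidefinite_above_of_less_consensus_index[OF index] .
  have "?M \<epsilon>\<^sub>1 *v x = 0 \<longleftrightarrow> ?M \<epsilon>\<^sub>2 *v x = 0" for x
    using L_neg_vanishes_on_repelling_kernel[OF \<delta>(2), of \<epsilon>\<^sub>1 x]
      L_neg_vanishes_on_repelling_kernel[OF \<delta>(2), of \<epsilon>\<^sub>2 x]
      repelling_laplacian_decrease[of \<epsilon>\<^sub>1 x \<epsilon>\<^sub>2] less \<delta>(1) by auto
  moreover have "x \<bullet> (?M \<epsilon>\<^sub>2 *v x) \<le> x \<bullet> (?M \<epsilon>\<^sub>1 *v x)" for x
    using positive_semidefinite_L_neg less
    by (simp add: positive_semidefinite_def repelling_laplacian_decrease[of \<epsilon>\<^sub>1 _ \<epsilon>\<^sub>2] inner_add_right)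
  moreover have "positive_semidefinite (?M \<epsilon>\<^sub>2)"
    using positive_semidefinite_repelling_laplacian_mono \<delta> by simp
  ultimately show ?thesis
    unfolding repelling_cost_def effective_cost_def
    by (intro pseudoinverse_quadratic_form_antimono transpose_repelling_laplacian) auto
qed

lemma resistance_eq_repelling_cost: "resistance E \<sigma> w i j = repelling_cost E \<sigma> w (-1) i j"
  by (simp add: resistance_def repelling_cost_def repelling_laplacian_def)

end

section \<open>Monotonicity of the repelling cost\<close>

theorem theorem1p3:
  fixes E :: "('v::finite \<times> 'v) set"
    and \<sigma> :: "'v \<Rightarrow> 'v \<Rightarrow> int"
    and w :: "'v \<Rightarrow> 'v \<Rightarrow> real"
  assumes "signed_graph E \<sigma> w"
    and "positive_connected E \<sigma>"
  shows "(\<forall>\<epsilon>\<^sub>1 \<epsilon>\<^sub>2 :: real. \<epsilon>\<^sub>1 < \<epsilon>\<^sub>2 \<and> ereal \<epsilon>\<^sub>2 < consensus_index E \<sigma> w \<longrightarrow>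
            (\<forall>i j. repelling_cost E \<sigma> w \<epsilon>\<^sub>1 i j \<le> repelling_cost E \<sigma> w \<epsilon>\<^sub>2 i j)) \<and>
         (\<forall>\<epsilon> :: real. 0 < \<epsilon> \<and> ereal \<epsilon> < consensus_index E \<sigma> w \<longrightarrow>
            (\<forall>i j. resistance E \<sigma> w i j \<le> repelling_cost E \<sigma> w \<epsilon> i j))"
proof -
  interpret signed_graph E \<sigma> w by (rule assms(1))
  show ?thesis
    by (auto simp: resistance_eq_repelling_cost intro!: repelling_cost_mono)
qed

end
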